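(* Let $X$ be a topological vector space and let $T\in L(X)$ be such that the space $$\Lambda(T)=\operatorname{span}\left(\bigcup_{n\in\mathbb N,\ z\in\mathbb K,\ |z|=1}\bigl((T-zI)^n(X)\cap\ker(T-zI)^n\bigr)\right)$$ is dense in $X$. Then $T$ is mixing. If additionally $X$ is Baire, separable and metrizable, then $T$ is hereditarily hypercyclic.
   Context: Conventions: $\mathbb K$ is $\mathbb R$ or $\mathbb C$; all vector spaces are non-zero and over $\mathbb K$; all topological spaces are Hausdorff; $\mathbb N=\{1,2,\dots\}$, $\mathbb Z_+=\{0,1,2,\dots\}$. $L(X)$ is the space of continuous linear operators on $X$. $T\in L(X)$ is mixing if for any non-empty open $U,V\subseteq X$ there is $r>0$ such that $T^n(U)\cap V\neq\varnothing$ for all integers $n>r$. $T$ is hereditarily hypercyclic if for any sequence $\{n_k\}_{k\in\mathbb Z_+}$ of non-negative integers with $n_k\to\infty$ there is $x\in X$ such that $\{T^{n_k}x:k\in\mathbb Z_+\}$ is dense in $X$. *)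

theory Defs
  imports "HOL-Analysis.Analysis"
begin

text \<open>
  The scalar field is a type of class real_normed_field.  The instances relevant here are
  real and complex; by the Gelfand--Mazur theorem every type of this class is, as a normed
  field, isomorphic to one of these two.  Working with an explicit scalar multiplication treats
  both cases at once (the libraries have no type class of complex vector spaces).
  Hausdorffness of the space is the class t2_space; the class topological_ab_group_add says
  that addition and negation are continuous.
\<close>

locale topological_vector_space = vector_space scl
  for scl :: "'k::real_normed_field \<Rightarrow> 'a::{topological_ab_group_add, t2_space} \<Rightarrow> 'a" +
  assumes continuous_scale: "continuous_on UNIV (\<lambda>(c, x). scl c x)"

definition continuous_linear_operators ::
    "('k::field \<Rightarrow> 'a::{ab_group_add, topological_space} \<Rightarrow> 'a) \<Rightarrow> ('a \<Rightarrow> 'a) set" where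
  "continuous_linear_operators scl =
     {T. Vector_Spaces.linear scl scl T \<and> continuous_on UNIV T}"

definition shifted_power ::
    "('k \<Rightarrow> 'a::ab_group_add \<Rightarrow> 'a) \<Rightarrow> ('a \<Rightarrow> 'a) \<Rightarrow> 'k \<Rightarrow> nat \<Rightarrow> 'a \<Rightarrow> 'a" where
  "shifted_power scl T z n = (\<lambda>x. T x - scl z x) ^^ n"

definition Lambda ::
    "('k::real_normed_field \<Rightarrow> 'a::ab_group_add \<Rightarrow> 'a) \<Rightarrow> ('a \<Rightarrow> 'a) \<Rightarrow> 'a set" where
  "Lambda scl T =
     module.span scl
       (\<Union>n\<in>{1..}. \<Union>z\<in>{z. norm z = 1}.
          range (shifted_power scl T z n) \<inter> {x. shifted_power scl T z n x = 0})"

definition dense :: "'a::topological_space set \<Rightarrow> bool" where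
  "dense S \<longleftrightarrow> closure S = UNIV"

definition mixing :: "('a::topological_space \<Rightarrow> 'a) \<Rightarrow> bool" where
  "mixing T \<longleftrightarrow>
     (\<forall>U V. open U \<longrightarrow> U \<noteq> {} \<longrightarrow> open V \<longrightarrow> V \<noteq> {} \<longrightarrow>
        (\<exists>r::nat. r > 0 \<and> (\<forall>n>r. (T ^^ n) ` U \<inter> V \<noteq> {})))"

definition hereditarily_hypercyclic :: "('a::topological_space \<Rightarrow> 'a) \<Rightarrow> bool" where
  "hereditarily_hypercyclic T \<longleftrightarrow>
     (\<forall>n::nat \<Rightarrow> nat. filterlim n at_top sequentially \<longrightarrow>
        (\<exists>x. dense (range (\<lambda>k. (T ^^ n k) x))))"

definition Baire_space :: "'a::topological_space itself \<Rightarrow> bool" where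
  "Baire_space _ \<longleftrightarrow>
     (\<forall>G::'a set set. countable G \<longrightarrow> (\<forall>U\<in>G. open U \<and> dense U) \<longrightarrow> dense (\<Inter>G))"

end

theory Submission
  imports Defs
begin

text \<open>
  Call a pair (u, v) joined if there are vectors x(k) tending to u such that T^k x(k) tends to v.
  The joined pairs form a subspace of the square of the space, so it suffices to join each
  generator of Lambda(T) to 0 and 0 to each generator; density of Lambda(T) then gives mixing,
  and the Baire category theorem gives the rest.

  A generator is N^n y with N = T - z and N^(2n) y = 0, so power series in N modulo N^(2n) act on y.
  With L = log(1 + N/z) one has T^k = z^k exp(k L), and L^n may be used in place of N^n, as L is N
  times a unit.  As in Pade approximation, some polynomial c of degree below n makes
  exp(t) c(t) equal to t^n plus terms of degree below n, modulo t^(2n).  Then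
  x(k) = z^(-k) k^(-n) c(k L) y tends to 0, whereas T^k x(k) tends to L^n y, because every other
  term carries a negative power of k.  Using exp(-t) instead joins L^n y to 0.
\<close>

unbundle no vec_syntax
unbundle fps_syntax

section \<open>Topology: countable bases, density and the Baire category argument\<close>

lemma second_countable_if_metrizable_separable:
  assumes "metrizable_space X" "separable_space X"
  shows "second_countable X"
proof -
  obtain M d where M: "Metric_space M d" and X: "X = Metric_space.mtopology M d"
    using assms(1) unfolding metrizable_space_def by blast
  interpret Metric_space M d by fact
  obtain C where C: "countable C" "C \<subseteq> M" "mtopology closure_of C = M"
    using assms(2) unfolding separable_space_def X by auto
  let ?B = "(\<lambda>(c, n). mball c (1 / real (Suc n))) ` (C \<times> (UNIV::nat set))"
  have "\<exists>V\<in>?B. x \<in> V \<and> V \<subseteq> U" if U: "openin mtopology U" "x \<in> U" for U x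
  proof -
    have xM: "x \<in> M" using U openin_mtopology by auto
    obtain r where r: "r > 0" "mball x r \<subseteq> U"
      using U openin_mtopology by blast
    \<comment> \<open>Half of \<open>r\<close>: the ball of this smaller radius about a centre that
      close to \<open>x\<close> contains \<open>x\<close> and, by the triangle inequality, stays
      inside \<open>mball x r\<close>.\<close>
    obtain n where n: "1 / real (Suc n) < r / 2"
      using r by (metis half_gt_zero nat_approx_posE)
    have "x \<in> mtopology closure_of C" using C xM by auto
    then obtain c where c: "c \<in> C" "c \<in> mball x (1 / real (Suc n))"
      unfolding metric_closure_of by (smt (verit) mem_Collect_eq of_nat_0_less_iff zero_less_Suc zero_less_divide_1_iff)
    have "x \<in> mball c (1 / real (Suc n))"
      using c by (simp add: commute)
    moreover have "mball c (1 / real (Suc n)) \<subseteq> mball x r"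
    proof
      fix y assume "y \<in> mball c (1 / real (Suc n))"
      then show "y \<in> mball x r"
        using c n triangle[of x c y] xM by simp
    qed
    ultimately show ?thesis using c r by blast
  qed
  moreover have "countable ?B" using C by auto
  moreover have "\<forall>V\<in>?B. openin mtopology V" by auto
  ultimately show ?thesis unfolding second_countable_def X by blast
qed

lemma dense_iff: "dense S \<longleftrightarrow> (\<forall>U. open U \<longrightarrow> U \<noteq> {} \<longrightarrow> S \<inter> U \<noteq> {})"
  unfolding dense_def
proof safe
  fix U :: "'a set" and x
  assume "closure S = UNIV" "open U" "x \<in> U" "S \<inter> U = {}"
  then show "x \<in> {}" using closure_iff_nhds_not_empty[of x S] by blast
next
  fix x assume "\<forall>U. open U \<longrightarrow> U \<noteq> {} \<longrightarrow> S \<inter> U \<noteq> {}"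
  then show "x \<in> closure S" by (subst closure_iff_nhds_not_empty) blast
qed simp

lemma continuous_on_funpow:
  fixes f :: "'a::topological_space \<Rightarrow> 'a"
  assumes "continuous_on UNIV f"
  shows "continuous_on UNIV (f ^^ n)"
proof (induction n)
  case (Suc n)
  then show ?case
    using continuous_on_compose[of UNIV "f ^^ n" f] continuous_on_subset[OF assms] by simp
qed (simp add: id_def continuous_on_id)

text \<open>For each non-empty basic open set \<open>V\<close>, the points that enter
  \<open>V\<close> at some time \<open>n k\<close> form an open set, which is dense because mixing
  applies once \<open>n k\<close> exceeds the threshold. By Baire some point lies in all these
  countably many sets.\<close>

lemma mixing_imp_hereditarily_hypercyclic:
  fixes T :: "'a::topological_space \<Rightarrow> 'a"
  assumes cont: "continuous_on UNIV T" and mix: "mixing T"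
    and Baire: "Baire_space TYPE('a)"
    and sc: "second_countable (euclidean :: 'a topology)"
  shows "hereditarily_hypercyclic T"
  unfolding hereditarily_hypercyclic_def
proof (intro allI impI)
  fix n :: "nat \<Rightarrow> nat" assume n: "filterlim n at_top sequentially"
  obtain B :: "'a set set" where B: "countable B" "\<And>V. V \<in> B \<Longrightarrow> open V"
      "\<And>U x. open U \<Longrightarrow> x \<in> U \<Longrightarrow> \<exists>V\<in>B. x \<in> V \<and> V \<subseteq> U"
    using sc unfolding second_countable_def by auto
  let ?W = "\<lambda>V. \<Union>k. (T ^^ n k) -` V"
  have op: "open (?W V)" if "open V" for V
    using continuous_on_funpow[OF cont] that
    by (intro open_UN ballI) (simp add: continuous_on_open_vimage)
  have de: "dense (?W V)" if V: "open V" "V \<noteq> {}" for V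
    unfolding dense_iff
  proof (intro allI impI)
    fix U :: "'a set" assume "open U" "U \<noteq> {}"
    then obtain r where r: "\<And>m. m > r \<Longrightarrow> (T ^^ m) ` U \<inter> V \<noteq> {}"
      using mix V unfolding mixing_def by meson
    have "eventually (\<lambda>k. n k > r) sequentially"
      using filterlim_iff[THEN iffD1, OF n] eventually_gt_at_top by blast
    then obtain k where "n k > r"
      using eventually_happens'[OF sequentially_bot] by blast
    then show "?W V \<inter> U \<noteq> {}" using r[of "n k"] by blast
  qed
  let ?G = "?W ` (B - {{}})"
  have "countable ?G" "\<forall>U\<in>?G. open U \<and> dense U"
    using B(1) op[OF B(2)] de[OF B(2)] by (simp, blast)
  then have "dense (\<Inter>?G)" using Baire unfolding Baire_space_def by blast
  then obtain x where x: "x \<in> \<Inter>?G" unfolding dense_iff by blast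
  have "dense (range (\<lambda>k. (T ^^ n k) x))"
    unfolding dense_iff
  proof (intro allI impI)
    fix U :: "'a set" assume "open U" "U \<noteq> {}"
    then obtain V where "V \<in> B - {{}}" "V \<subseteq> U" using B by blast
    then show "range (\<lambda>k. (T ^^ n k) x) \<inter> U \<noteq> {}" using x by blast
  qed
  then show "\<exists>x. dense (range (\<lambda>k. (T ^^ n k) x))" ..
qed

section \<open>Polynomials whose product with an exponential has a gap\<close>

lemma smult_add_pderiv_surj:
  fixes g :: "'k::field_char_0 poly"
  assumes "l \<noteq> 0"
  shows "\<exists>c. degree c \<le> degree g \<and> smult l c + pderiv c = g"
proof (induction "degree g" arbitrary: g rule: less_induct)
  case less
  show ?case
  proof (cases "degree g = 0")
    case True
    then obtain a where "g = [:a:]" by (metis degree_0_id)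
    then show ?thesis using assms by (intro exI[of _ "[:a / l:]"]) simp
  next
    case False
    have d: "degree (pderiv g) < degree g"
      using False by (simp add: degree_pderiv)
    then obtain h where h: "degree h \<le> degree (pderiv g)" "smult l h + pderiv h = pderiv g"
      using less by blast
    \<comment> \<open>As \<open>h\<close> solves the equation for \<open>pderiv g\<close>, the
      difference \<open>pderiv g - pderiv h\<close> is \<open>smult l h\<close>. Hence the
      derivative of \<open>(g - h) / l\<close> is \<open>h\<close>, which compensates the
      \<open>- h\<close>.\<close>
    have "smult l (smult (1 / l) (g - h)) + pderiv (smult (1 / l) (g - h)) = g"
      using assms arg_cong[OF h(2), of "smult (1 / l)"]
      by (simp add: pderiv_smult pderiv_diff smult_diff_right smult_add_right algebra_simps)
    moreover have "degree (smult (1 / l) (g - h)) \<le> degree g"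
      using h d by (intro order.trans[OF degree_smult_le] degree_diff_le) auto
    ultimately show ?thesis by blast
  qed
qed

lemma funpow_smult_add_pderiv_surj:
  fixes g :: "'k::field_char_0 poly"
  assumes "l \<noteq> 0"
  shows "\<exists>c. degree c \<le> degree g \<and> ((\<lambda>c. smult l c + pderiv c) ^^ n) c = g"
proof (induction n arbitrary: g)
  case (Suc n)
  obtain h where h: "degree h \<le> degree g" "smult l h + pderiv h = g"
    using smult_add_pderiv_surj[OF assms] by blast
  obtain c where "degree c \<le> degree h" "((\<lambda>c. smult l c + pderiv c) ^^ n) c = h"
    using Suc by blast
  with h show ?case by (intro exI[of _ c]) auto
qed auto

text \<open>In characteristic zero the factor \<open>(m + 1) ... (m + n)\<close> is non-zero, so the
  coefficients of \<open>f\<close> from index \<open>n\<close> on can be read off from the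
  \<open>n\<close>-th derivative.\<close>

lemma fps_deriv_funpow_nth:
  fixes f :: "'k::comm_ring_1 fps"
  shows "(fps_deriv ^^ n) f $ m = pochhammer (of_nat (Suc m)) n * f $ (m + n)"
proof (induction n arbitrary: m)
  case (Suc n)
  then show ?case
    by (simp add: pochhammer_rec algebra_simps)
qed simp

text \<open>
  Differentiating n times reduces the claim to solving (l + d/dt)^n c = n! exp(- l t) modulo t^n
  for a polynomial c, which is possible since d/dt is nilpotent on polynomials of bounded degree.
\<close>

lemma exists_poly_fps_exp_mult_gap:
  fixes l :: "'k::field_char_0"
  assumes "l \<noteq> 0" "n > 0"
  shows "\<exists>c. degree c < n \<and> (fps_exp l * fps_of_poly c) $ n = 1 \<and>
      (\<forall>j. n < j \<longrightarrow> j < 2 * n \<longrightarrow> (fps_exp l * fps_of_poly c) $ j = 0)"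
proof -
  let ?D = "\<lambda>c. smult l c + pderiv c"
  define t where "t = fps_const (fact n) * fps_exp (- l)"
  define g where "g = poly_of_list (map (fps_nth t) [0..<n])"
  have g_coeff: "coeff g m = t $ m" if "m < n" for m
    using that by (simp add: g_def nth_default_def)
  have "coeff g m = 0" if "m \<ge> n" for m
    using that by (simp add: g_def nth_default_def)
  then have "degree g < n"
    using assms(2) by (metis coeff_0 degree_0 leading_coeff_0_iff linorder_not_less)
  obtain c where c: "degree c \<le> degree g" "(?D ^^ n) c = g"
    using funpow_smult_add_pderiv_surj[OF assms(1)] by blast
  let ?f = "fps_exp l * fps_of_poly c"
  \<comment> \<open>By the product rule, differentiating \<open>fps_exp l\<close> times a polynomial
    amounts to applying \<open>?D\<close> to the polynomial.\<close>
  have "(fps_deriv ^^ m) (fps_exp l * fps_of_poly c) = fps_exp l * fps_of_poly ((?D ^^ m) c)" for m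
    by (induction m) (simp_all add: fps_of_poly_simps algebra_simps flip: fps_of_poly_pderiv)
  then have D: "(fps_deriv ^^ n) ?f = fps_exp l * fps_of_poly g" using c by simp
  have D': "(fps_exp l * fps_of_poly g) $ m = (if m = 0 then fact n else 0)" if "m < n" for m
  proof -
    have "(fps_exp l * fps_of_poly g) $ m = (fps_exp l * t) $ m"
      unfolding fps_mult_nth using that by (intro sum.cong refl) (simp add: g_coeff)
    also have "fps_exp l * t = fps_const (fact n)"
      using fps_exp_add_mult[of l "- l"] by (simp add: t_def mult.left_commute)
    finally show ?thesis by simp
  qed
  have P: "pochhammer (of_nat (Suc m)) n * ?f $ (m + n) = (if m = 0 then fact n else 0)" if "m < n" for m
    using D'[OF that] unfolding D[symmetric] fps_deriv_funpow_nth .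
  \<comment> \<open>For \<open>m = 0\<close> the Pochhammer factor is \<open>fact n\<close>; the
    normalisation of \<open>t\<close> thus makes the coefficient at \<open>n\<close> equal to
    1.\<close>
  have nth: "?f $ (m + n) = (if m = 0 then 1 else 0)" if "m < n" for m
  proof -
    have "pochhammer (of_nat (Suc m)) n \<noteq> (0 :: 'k)"
      using pochhammer_of_nat[of "Suc m" n, where 'a = 'k] pochhammer_pos[of "Suc m" n] by (simp del: of_nat_Suc)
    with P[OF that] show ?thesis
      by (auto simp: pochhammer_fact split: if_splits)
  qed
  have "?f $ j = 0" if "n < j" "j < 2 * n" for j
    using nth[of "j - n"] that by simp
  moreover have "?f $ n = 1" using nth[of 0] assms(2) by simp
  moreover have "degree c < n" using c \<open>degree g < n\<close> by simp
  ultimately show ?thesis by blast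
qed

section \<open>Substituting a logarithm into power series\<close>

lemma exists_fps_log:
  fixes z :: "'k::field_char_0"
  assumes "z \<noteq> 0"
  shows "\<exists>L. L $ 0 = 0 \<and> L $ 1 \<noteq> 0 \<and>
    (\<forall>k. (fps_const z + fps_X) ^ k = fps_const (z ^ k) * (fps_exp (of_nat k) oo L))"
proof -
  let ?e = "fps_exp (1::'k) - 1"
  let ?X = "fps_const (1 / z) * fps_X"
  \<comment> \<open>The compositional inverse of \<open>exp X - 1\<close> is
    \<open>log (1 + X)\<close>, so \<open>L\<close> is \<open>log (1 + X / z)\<close>.\<close>
  define L where "L = fps_inv ?e oo ?X"
  have inv0: "fps_inv ?e $ 0 = 0" by (simp add: fps_inv_def)
  have L0: "L $ 0 = 0" unfolding L_def by (simp add: inv0)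
  have "L $ 1 = (1 / z) ^ 1 * fps_inv ?e $ 1" unfolding L_def fps_nth_compose_linear ..
  also have "fps_inv ?e $ 1 = 1" by (simp add: fps_inv_def)
  finally have L1: "L $ 1 \<noteq> 0" using assms by simp
  have "?e oo L = (?e oo fps_inv ?e) oo ?X"
    unfolding L_def by (rule fps_compose_assoc) (simp_all add: inv0)
  also have "?e oo fps_inv ?e = fps_X" by (rule fps_inv_right) simp_all
  also have "fps_X oo ?X = ?X" by simp
  finally have "fps_exp 1 oo L = 1 + ?X"
    by (simp add: fps_compose_sub_distrib algebra_simps)
  then have "fps_const z * (fps_exp 1 oo L) = fps_const z + fps_X"
    using assms by (simp add: distrib_left flip: mult.assoc)
  then have "(fps_const z + fps_X) ^ k = fps_const z ^ k * (fps_exp 1 oo L) ^ k" for k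
    by (metis power_mult_distrib)
  then have "(fps_const z + fps_X) ^ k = fps_const (z ^ k) * (fps_exp (of_nat k) oo L)" for k
    using fps_compose_power[OF L0, of "fps_exp 1" k]
    by (simp add: fps_exp_power_mult fps_const_power)
  with L0 L1 show ?thesis by blast
qed

text \<open>As \<open>L\<close> has no constant term, \<open>L ^ j\<close> starts at degree
  \<open>j\<close> or later, so only the terms with \<open>j < M\<close> reach a coefficient below
  \<open>M\<close>.\<close>

lemma fps_compose_mult_nth:
  fixes g :: "'k::comm_ring_1 fps"
  assumes "L $ 0 = 0" "m < M"
  shows "((g oo L) * V) $ m = (\<Sum>j<M. fps_const (g $ j) * (L ^ j * V)) $ m"
proof -
  have "(g oo L) $ i = (\<Sum>j<M. fps_const (g $ j) * L ^ j) $ i" if "i \<le> m" for i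
    unfolding fps_compose_nth fps_sum_nth using that assms
    by (intro sum.mono_neutral_cong_left) (auto simp: startsby_zero_power_prefix)
  then have "((g oo L) * V) $ m = ((\<Sum>j<M. fps_const (g $ j) * L ^ j) * V) $ m"
    unfolding fps_mult_nth by simp
  then show ?thesis by (simp add: sum_distrib_right mult.assoc)
qed

text \<open>\<open>L\<close> is \<open>fps_X\<close> times a unit, and \<open>V\<close> is the
  inverse unit to the power \<open>n\<close>. This factor later turns \<open>L ^ n\<close> into
  \<open>fps_X ^ n\<close>.\<close>

lemma fps_X_power_eq_power_mult:
  fixes L :: "'k::field fps"
  assumes "L $ 0 = 0" "L $ 1 \<noteq> 0"
  shows "\<exists>V. L ^ n * V = fps_X ^ n"
proof -
  let ?W = "fps_shift 1 L"
  have L: "L = fps_X * ?W"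
    using assms by (intro fps_ext) auto
  have "?W * inverse ?W = 1"
    using assms by (simp add: inverse_mult_eq_1')
  then have "L ^ n * inverse ?W ^ n = fps_X ^ n"
    by (subst L) (metis mult.assoc mult.right_neutral power_mult_distrib)
  then show ?thesis ..
qed

section \<open>Power series in an operator, applied to a vector\<close>

context topological_vector_space
begin

lemma tendsto_scale:
  assumes "(f \<longlongrightarrow> c) F"
  shows "((\<lambda>k. scl (f k) v) \<longlongrightarrow> scl c v) F"
proof -
  have "isCont (\<lambda>(c, x). scl c x) (c, v)"
    using continuous_scale by (simp add: continuous_on_eq_continuous_at)
  from isCont_tendsto_compose[OF this tendsto_Pair[OF assms tendsto_const]]
  show ?thesis by simp
qed

text \<open>This represents \<open>f(N) y\<close>. Cutting the series at \<open>M\<close> is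
  harmless for linear \<open>N\<close> with \<open>(N ^^ M) y = 0\<close>: the power series ring
  then acts through its quotient modulo \<open>fps_X ^ M\<close>.\<close>

definition fps_apply :: "('a \<Rightarrow> 'a) \<Rightarrow> nat \<Rightarrow> 'a \<Rightarrow> 'k fps \<Rightarrow> 'a" where
  "fps_apply N M y f = (\<Sum>j<M. scl (f $ j) ((N ^^ j) y))"

lemma fps_apply_cong:
  "(\<And>j. j < M \<Longrightarrow> f $ j = g $ j) \<Longrightarrow> fps_apply N M y f = fps_apply N M y g"
  by (simp add: fps_apply_def)

lemma fps_apply_add: "fps_apply N M y (f + g) = fps_apply N M y f + fps_apply N M y g"
  by (simp add: fps_apply_def scale_left_distrib sum.distrib)

lemma fps_apply_const_mult: "fps_apply N M y (fps_const c * f) = scl c (fps_apply N M y f)"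
  by (simp add: fps_apply_def scale_sum_right)

lemma fps_apply_sum: "fps_apply N M y (\<Sum>i\<in>I. f i) = (\<Sum>i\<in>I. fps_apply N M y (f i))"
  unfolding fps_apply_def fps_sum_nth scale_sum_left by (rule sum.swap)

lemma fps_apply_X_power:
  assumes "n < M"
  shows "fps_apply N M y (fps_X ^ n) = (N ^^ n) y"
proof -
  have "fps_apply N M y (fps_X ^ n) = (\<Sum>j<M. if j = n then (N ^^ j) y else 0)"
    unfolding fps_apply_def by (intro sum.cong) auto
  also have "\<dots> = (N ^^ n) y" using assms by simp
  finally show ?thesis .
qed

text \<open>Applying \<open>N\<close> shifts the indices by one: the new bottom coefficient is 0,
  and the overflowing term of index \<open>M\<close> vanishes because
  \<open>(N ^^ M) y = 0\<close>.\<close>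

lemma fps_apply_X_mult:
  assumes "Vector_Spaces.linear scl scl N" "(N ^^ M) y = 0"
  shows "N (fps_apply N M y f) = fps_apply N M y (fps_X * f)"
proof -
  interpret N: Vector_Spaces.linear scl scl N by fact
  have "N (fps_apply N M y f) = (\<Sum>j<M. scl ((fps_X * f) $ Suc j) ((N ^^ Suc j) y))"
    by (simp add: fps_apply_def N.sum N.scale)
  also have "\<dots> = (\<Sum>j<Suc M. scl ((fps_X * f) $ j) ((N ^^ j) y))"
    by (subst sum.lessThan_Suc_shift) simp
  also have "\<dots> = fps_apply N M y (fps_X * f)"
    using assms(2) by (simp add: fps_apply_def)
  finally show ?thesis .
qed

text \<open>\<open>T\<close> acts on these vectors as multiplication by
  \<open>fps_const z + fps_X\<close>, whose powers can be rewritten through the logarithm.\<close>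

lemma funpow_fps_apply:
  assumes "Vector_Spaces.linear scl scl N" "(N ^^ M) y = 0"
    and T: "\<And>x. T x = scl z x + N x"
  shows "(T ^^ k) (fps_apply N M y f) = fps_apply N M y ((fps_const z + fps_X) ^ k * f)"
proof (induction k)
  case (Suc k)
  then show ?case
    by (simp add: T fps_apply_X_mult[OF assms(1,2)] distrib_right fps_apply_add
      fps_apply_const_mult mult.assoc)
qed simp

text \<open>For \<open>k > 0\<close>, the series \<open>L ^ j * V\<close> occurs with weight
  \<open>w k * k^(j - n) * a $ j\<close>. This tends to 0 for \<open>j < n\<close> since
  \<open>w\<close> is bounded, is 0 for \<open>n < j < 2 * n\<close> by the gap, and is constant for
  \<open>j = n\<close>, where either \<open>a $ n = 0\<close> or \<open>w\<close> is constantly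
  1.\<close>

lemma fps_apply_compose_tendsto:
  fixes a :: "'k fps" and w :: "nat \<Rightarrow> 'k"
  assumes L: "L $ 0 = 0" and w: "\<And>k. norm (w k) = 1"
    and gap: "\<And>j. n < j \<Longrightarrow> j < 2 * n \<Longrightarrow> a $ j = 0"
    and n: "n > 0" and wn: "a $ n = 0 \<or> (\<forall>k. w k = 1)"
  shows "(\<lambda>k. fps_apply N (2 * n) y (fps_const (w k / of_nat k ^ n) *
      (((a oo (fps_const (of_nat k) * fps_X)) oo L) * V)))
    \<longlonglongrightarrow> scl (a $ n) (fps_apply N (2 * n) y (L ^ n * V))"
proof -
  let ?v = "\<lambda>j. fps_apply N (2 * n) y (L ^ j * V)"
  let ?s = "\<lambda>k j. w k / of_nat k ^ n * (of_nat k ^ j * a $ j)"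
  have eq: "fps_apply N (2 * n) y (fps_const (w k / of_nat k ^ n) *
      (((a oo (fps_const (of_nat k) * fps_X)) oo L) * V)) = (\<Sum>j<2 * n. scl (?s k j) (?v j))" for k
  proof -
    have "fps_apply N (2 * n) y (((a oo (fps_const (of_nat k) * fps_X)) oo L) * V) =
        (\<Sum>j<2 * n. scl (of_nat k ^ j * a $ j) (?v j))"
      by (subst fps_apply_cong[OF fps_compose_mult_nth[OF L]])
        (simp_all add: fps_apply_sum fps_apply_const_mult)
    then show ?thesis by (simp only: fps_apply_const_mult scale_sum_right scale_scale)
  qed
  have lim: "(\<lambda>k. ?s k j) \<longlonglongrightarrow> (if j = n then a $ n else 0)" if j: "j < 2 * n" for j
  proof (cases j n rule: linorder_cases)
    case less
    have "(\<lambda>k. inverse (real k ^ (n - j)) * norm (a $ j)) \<longlonglongrightarrow> 0 * norm (a $ j)"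
      using less by (intro tendsto_mult tendsto_const tendsto_inverse_0_at_top
        filterlim_pow_at_top filterlim_real_sequentially) auto
    moreover have "eventually (\<lambda>k. inverse (real k ^ (n - j)) * norm (a $ j) = norm (?s k j)) sequentially"
      using eventually_gt_at_top[of 0]
    proof eventually_elim
      case (elim k)
      then show ?case using less
        by (simp add: norm_mult norm_divide norm_power w power_diff field_simps)
    qed
    ultimately have "(\<lambda>k. norm (?s k j)) \<longlonglongrightarrow> 0"
      using Lim_transform_eventually by fastforce
    then show ?thesis using less tendsto_norm_zero_iff by auto
  next
    case equal
    \<comment> \<open>Only \<open>k > 0\<close> is considered: at \<open>k = 0\<close> the division
      by zero yields 0, which need not be \<open>a $ n\<close>.\<close>
    have "eventually (\<lambda>k. a $ n = ?s k j) sequentially"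
      using eventually_gt_at_top[of 0]
    proof eventually_elim
      case (elim k)
      then have "of_nat k ^ n \<noteq> (0 :: 'k)" by simp
      then show ?case using wn equal by (auto simp del: power_eq_0_iff)
    qed
    then have "(\<lambda>k. ?s k j) \<longlonglongrightarrow> a $ n"
      by (intro tendsto_eventually) (simp add: eq_commute)
    then show ?thesis using equal by simp
  qed (use gap j in auto)
  have "(\<lambda>k. \<Sum>j<2 * n. scl (?s k j) (?v j)) \<longlonglongrightarrow> (\<Sum>j<2 * n. scl (if j = n then a $ n else 0) (?v j))"
    by (intro tendsto_sum tendsto_scale lim) simp
  also have "(\<Sum>j<2 * n. scl (if j = n then a $ n else 0) (?v j)) = (\<Sum>j<2 * n. if j = n then scl (a $ n) (?v n) else 0)"
    by (intro sum.cong) auto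
  also have "\<dots> = scl (a $ n) (?v n)" using n by simp
  finally show ?thesis unfolding eq .
qed

section \<open>Joined pairs from power series, and the generators of \<open>Lambda\<close>\<close>

definition orbit_joins :: "('a \<Rightarrow> 'a) \<Rightarrow> 'a \<Rightarrow> 'a \<Rightarrow> bool" where
  "orbit_joins T u v \<longleftrightarrow> (\<exists>x. x \<longlonglongrightarrow> u \<and> (\<lambda>k. (T ^^ k) (x k)) \<longlonglongrightarrow> v)"

text \<open>Since \<open>(z + X)^k = z^k exp(k L)\<close>, applying \<open>T ^^ k\<close> replaces
  the series \<open>a\<close> by \<open>b\<close> and the phase \<open>w k\<close> by
  \<open>w k * z ^ k\<close>. Both limits are then instances of
  \<open>fps_apply_compose_tendsto\<close>; a phase has to be trivial only on a side whose
  \<open>n\<close>-th coefficient is non-zero.\<close>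

lemma orbit_joins_fps:
  fixes a b :: "'k fps"
  assumes N: "Vector_Spaces.linear scl scl N" "(N ^^ (2 * n)) y = 0" "n > 0"
    and T: "\<And>x. T x = scl z x + N x" and z: "norm z = 1" and w: "\<And>k. norm (w k) = 1"
    and b: "b = fps_exp 1 * a"
    and gap: "\<And>j. n < j \<Longrightarrow> j < 2 * n \<Longrightarrow> a $ j = 0" "\<And>j. n < j \<Longrightarrow> j < 2 * n \<Longrightarrow> b $ j = 0"
    and wa: "a $ n = 0 \<or> (\<forall>k. w k = 1)" and wb: "b $ n = 0 \<or> (\<forall>k. w k * z ^ k = 1)"
  shows "orbit_joins T (scl (a $ n) ((N ^^ n) y)) (scl (b $ n) ((N ^^ n) y))"
proof -
  have "z \<noteq> 0" using z by auto
  then obtain L where L: "L $ 0 = 0" "L $ 1 \<noteq> 0"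
    "\<And>k. (fps_const z + fps_X) ^ k = fps_const (z ^ k) * (fps_exp (of_nat k) oo L)"
    using exists_fps_log by blast
  obtain V where V: "L ^ n * V = fps_X ^ n"
    using fps_X_power_eq_power_mult[OF L(1,2)] by blast
  have v: "fps_apply N (2 * n) y (L ^ n * V) = (N ^^ n) y"
    unfolding V using N(3) by (simp add: fps_apply_X_power)
  let ?c = "\<lambda>a k. (a oo (fps_const (of_nat k) * fps_X)) oo L"
  let ?x = "\<lambda>k. fps_apply N (2 * n) y (fps_const (w k / of_nat k ^ n) * (?c a k * V))"
  \<comment> \<open>Substitution is multiplicative and turns \<open>fps_exp 1\<close> into
    \<open>fps_exp (of_nat k)\<close>.\<close>
  have "fps_exp (of_nat k) * (a oo (fps_const (of_nat k) * fps_X)) =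
      b oo (fps_const (of_nat k) * fps_X)" for k
    unfolding b by (subst fps_compose_mult_distrib) simp_all
  then have c: "(fps_exp (of_nat k) oo L) * ?c a k = ?c b k" for k
    using fps_compose_mult_distrib[OF L(1)] by metis
  have "(T ^^ k) (?x k) =
      fps_apply N (2 * n) y (fps_const (w k * z ^ k / of_nat k ^ n) * (?c b k * V))" for k
  proof -
    have "(fps_const z + fps_X) ^ k * (fps_const (w k / of_nat k ^ n) * (?c a k * V)) =
        (fps_const (z ^ k) * fps_const (w k / of_nat k ^ n)) * (((fps_exp (of_nat k) oo L) * ?c a k) * V)"
      unfolding L(3) by (simp only: ac_simps)
    also have "\<dots> = fps_const (w k * z ^ k / of_nat k ^ n) * (?c b k * V)"
      unfolding c by (simp add: mult.commute)
    finally show ?thesis unfolding funpow_fps_apply[OF N(1,2) T] by (rule arg_cong)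
  qed
  moreover have "?x \<longlonglongrightarrow> scl (a $ n) ((N ^^ n) y)"
    unfolding v[symmetric] by (rule fps_apply_compose_tendsto) (fact L(1) w gap(1) N(3) wa)+
  moreover have "(\<lambda>k. fps_apply N (2 * n) y (fps_const (w k * z ^ k / of_nat k ^ n) * (?c b k * V)))
      \<longlonglongrightarrow> scl (b $ n) ((N ^^ n) y)"
    unfolding v[symmetric]
  proof (rule fps_apply_compose_tendsto)
    show "norm (w k * z ^ k) = 1" for k using z w by (simp add: norm_mult norm_power)
  qed (fact L(1) gap(2) N(3) wb)+
  ultimately show ?thesis unfolding orbit_joins_def by (intro exI[of _ ?x]) simp
qed

lemma orbit_joins_generator:
  assumes N: "Vector_Spaces.linear scl scl N" "(N ^^ (2 * n)) y = 0" "n > 0"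
    and T: "\<And>x. T x = scl z x + N x" and z: "norm z = 1"
  shows "orbit_joins T 0 ((N ^^ n) y)" "orbit_joins T ((N ^^ n) y) 0"
proof -
  have z0: "z \<noteq> 0" using z by auto
  obtain c where c: "degree c < n" "(fps_exp 1 * fps_of_poly c) $ n = (1 :: 'k)"
    "\<forall>j. n < j \<longrightarrow> j < 2 * n \<longrightarrow> (fps_exp 1 * fps_of_poly c) $ j = (0 :: 'k)"
    using exists_poly_fps_exp_mult_gap[OF _ N(3), of "1 :: 'k"] by auto
  have "coeff c j = 0" if "n \<le> j" for j using c(1) that by (simp add: coeff_eq_0)
  \<comment> \<open>The initial series \<open>c\<close> has no coefficient at \<open>n\<close>,
    which leaves the phase free: \<open>w k = z^(-k)\<close> cancels the factor \<open>z ^ k\<close>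
    in the final one.\<close>
  then show "orbit_joins T 0 ((N ^^ n) y)"
    using orbit_joins_fps[OF N T z, of "\<lambda>k. inverse (z ^ k)", OF _ refl, of "fps_of_poly c"] c z z0
    by (simp add: norm_inverse norm_power)
  obtain c where c: "degree c < n" "(fps_exp (-1) * fps_of_poly c) $ n = (1 :: 'k)"
    "\<forall>j. n < j \<longrightarrow> j < 2 * n \<longrightarrow> (fps_exp (-1) * fps_of_poly c) $ j = (0 :: 'k)"
    using exists_poly_fps_exp_mult_gap[OF _ N(3), of "-1 :: 'k"] by auto
  have "coeff c j = 0" if "n \<le> j" for j using c(1) that by (simp add: coeff_eq_0)
  moreover have "fps_of_poly c = fps_exp 1 * (fps_exp (-1) * fps_of_poly c)"
    by (metis add.right_inverse fps_exp_0 fps_exp_add_mult mult.assoc mult_1)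
  \<comment> \<open>Now \<open>c\<close> is the final series. It has no coefficient at
    \<open>n\<close>, so the phase \<open>z ^ k\<close> does no harm there and \<open>w\<close> can
    be constantly 1.\<close>
  ultimately show "orbit_joins T ((N ^^ n) y) 0"
    using orbit_joins_fps[OF N T z, of "\<lambda>k. 1" "fps_of_poly c" "fps_exp (-1) * fps_of_poly c"] c
    by simp
qed

section \<open>Linearity of the joined relation, passage to \<open>Lambda\<close>, and
  mixing\<close>

lemma linear_funpow:
  assumes "Vector_Spaces.linear scl scl T"
  shows "Vector_Spaces.linear scl scl (T ^^ k)"
proof (induction k)
  case (Suc k)
  show ?case unfolding funpow.simps(2) using Suc assms by (rule Vector_Spaces.linear_compose)
qed (simp add: id_def linear_ident)

lemma orbit_joins_add:
  assumes "Vector_Spaces.linear scl scl T" "orbit_joins T u v" "orbit_joins T u' v'"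
  shows "orbit_joins T (u + u') (v + v')"
proof -
  interpret Tk: Vector_Spaces.linear scl scl "T ^^ k" for k
    by (rule linear_funpow[OF assms(1)])
  obtain x x' where "x \<longlonglongrightarrow> u" "(\<lambda>k. (T ^^ k) (x k)) \<longlonglongrightarrow> v"
    "x' \<longlonglongrightarrow> u'" "(\<lambda>k. (T ^^ k) (x' k)) \<longlonglongrightarrow> v'"
    using assms(2,3) unfolding orbit_joins_def by blast
  then show ?thesis unfolding orbit_joins_def
    by (intro exI[of _ "\<lambda>k. x k + x' k"])
      (simp add: tendsto_add Tk.add)
qed

lemma tendsto_scale_right:
  assumes "(f \<longlongrightarrow> v) F"
  shows "((\<lambda>k. scl c (f k)) \<longlongrightarrow> scl c v) F"
proof -
  have "isCont (\<lambda>(c, x). scl c x) (c, v)"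
    using continuous_scale by (simp add: continuous_on_eq_continuous_at)
  from isCont_tendsto_compose[OF this tendsto_Pair[OF tendsto_const assms]]
  show ?thesis by simp
qed

lemma orbit_joins_scale:
  assumes "Vector_Spaces.linear scl scl T" "orbit_joins T u v"
  shows "orbit_joins T (scl c u) (scl c v)"
proof -
  interpret Tk: Vector_Spaces.linear scl scl "T ^^ k" for k
    by (rule linear_funpow[OF assms(1)])
  obtain x where "x \<longlonglongrightarrow> u" "(\<lambda>k. (T ^^ k) (x k)) \<longlonglongrightarrow> v"
    using assms(2) unfolding orbit_joins_def by blast
  then show ?thesis unfolding orbit_joins_def
    by (intro exI[of _ "\<lambda>k. scl c (x k)"])
      (simp add: tendsto_scale_right Tk.scale)
qed

lemma orbit_joins_zero:
  assumes "Vector_Spaces.linear scl scl T"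
  shows "orbit_joins T 0 0"
proof -
  interpret Tk: Vector_Spaces.linear scl scl "T ^^ k" for k
    by (rule linear_funpow[OF assms])
  show ?thesis
    unfolding orbit_joins_def by (intro exI[of _ "\<lambda>k. 0"]) (simp add: Tk.zero)
qed

lemma orbit_joins_Lambda:
  assumes T: "Vector_Spaces.linear scl scl T" and "u \<in> Lambda scl T" "v \<in> Lambda scl T"
  shows "orbit_joins T u v"
proof -
  interpret T: Vector_Spaces.linear scl scl T by fact
  \<comment> \<open>Both directions are kept so that adding the pairs \<open>(u, 0)\<close> and
    \<open>(0, v)\<close> joins any \<open>u\<close> and \<open>v\<close> of the span.\<close>
  let ?S = "{u. orbit_joins T u 0 \<and> orbit_joins T 0 u}"
  have "subspace ?S"
    using orbit_joins_zero[OF T] orbit_joins_add[OF T, of _ 0 _ 0] orbit_joins_add[OF T, of 0 _ 0]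
      orbit_joins_scale[OF T, of _ 0] orbit_joins_scale[OF T, of 0]
    by (intro subspaceI) simp_all
  moreover have "x \<in> ?S" if n: "n \<ge> 1" and z: "norm z = 1"
    and x: "x \<in> range (shifted_power scl T z n)" "shifted_power scl T z n x = 0" for n z x
  proof -
    let ?N = "\<lambda>x. T x - scl z x"
    have N: "Vector_Spaces.linear scl scl ?N"
      by unfold_locales (simp_all add: T.add T.scale scale_right_distrib scale_right_diff_distrib mult.commute)
    obtain y where y: "x = (?N ^^ n) y" using x(1) unfolding shifted_power_def by blast
    \<comment> \<open>\<open>?N ^^ n\<close> kills \<open>x\<close>, which is itself
      \<open>(?N ^^ n) y\<close>.\<close>
    have "(?N ^^ (2 * n)) y = 0"
      using x(2) unfolding y shifted_power_def mult_2 funpow_add by simp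
    from orbit_joins_generator[OF N this _ _ z] n show ?thesis unfolding y by simp
  qed
  ultimately have "Lambda scl T \<subseteq> ?S"
    unfolding Lambda_def by (intro span_minimal) auto
  then show ?thesis using assms orbit_joins_add[OF T, of u 0 0 v] by auto
qed

text \<open>By density \<open>U\<close> and \<open>V\<close> contain vectors of
  \<open>Lambda\<close>; a sequence joining them eventually lies in \<open>U\<close> while its
  images lie in \<open>V\<close>.\<close>

lemma mixing_if_dense_Lambda:
  assumes T: "Vector_Spaces.linear scl scl T" and d: "dense (Lambda scl T)"
  shows "mixing T"
  unfolding mixing_def
proof (intro allI impI)
  fix U V :: "'a set" assume U: "open U" "U \<noteq> {}" and V: "open V" "V \<noteq> {}"
  obtain u v where uv: "u \<in> Lambda scl T" "u \<in> U" "v \<in> Lambda scl T" "v \<in> V"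
    using d U V unfolding dense_iff by blast
  then have "orbit_joins T u v" by (intro orbit_joins_Lambda[OF T])
  then obtain x where x: "x \<longlonglongrightarrow> u" "(\<lambda>k. (T ^^ k) (x k)) \<longlonglongrightarrow> v"
    unfolding orbit_joins_def by blast
  have "eventually (\<lambda>k. x k \<in> U \<and> (T ^^ k) (x k) \<in> V) sequentially"
    using x uv U(1) V(1) by (intro eventually_conj topological_tendstoD)
  then obtain r where r: "\<And>k. k \<ge> r \<Longrightarrow> x k \<in> U \<and> (T ^^ k) (x k) \<in> V"
    unfolding eventually_sequentially by blast
  \<comment> \<open>\<open>Suc r\<close> serves as threshold because \<open>mixing\<close> asks for
    a positive one.\<close>
  have "(T ^^ n) ` U \<inter> V \<noteq> {}" if "n > Suc r" for n
    using r[of n] that by auto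
  then show "\<exists>r>0. \<forall>n>r. (T ^^ n) ` U \<inter> V \<noteq> {}" by blast
qed

end

theorem theorem1p18:
  fixes scl :: "'k::real_normed_field \<Rightarrow> 'a::{topological_ab_group_add, t2_space} \<Rightarrow> 'a"
    and T :: "'a \<Rightarrow> 'a"
  assumes tvs: "topological_vector_space scl"
    and nonzero: "(UNIV :: 'a set) \<noteq> {0}"
    and T: "T \<in> continuous_linear_operators scl"
    and dense_Lambda: "dense (Lambda scl T)"
  shows "mixing T \<and>
    (Baire_space TYPE('a) \<and> separable_space (euclidean :: 'a topology) \<and>
       metrizable_space (euclidean :: 'a topology) \<longrightarrow> hereditarily_hypercyclic T)"
proof -
  have "mixing T"
    using T topological_vector_space.mixing_if_dense_Lambda[OF tvs _ dense_Lambda]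
    unfolding continuous_linear_operators_def by blast
  then show ?thesis
    using T mixing_imp_hereditarily_hypercyclic second_countable_if_metrizable_separable
    unfolding continuous_linear_operators_def by blast
qed

end
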